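(* For all integers $i,j,k,L_1,L_2,M$ one has \[ g_{i,j,k}(L_1,L_2,M)=p_{i,j,k}(L_1,L_2,M), \] where \begin{align*} g_{i,j,k}(L_1,L_2,M) :={}& \sum q^{T_t+T_{n_{ab}}+T_{n_{ac}}+T_{n_{bc}-1}}\\ &\times \Bigg\{ q^{n_{bc}} \begin{bmatrix}L_1-t+a\\ a\end{bmatrix}_q \begin{bmatrix}L_2-t+b\\ b\end{bmatrix}_q \begin{bmatrix}L_2-t\\ n_{ab}\end{bmatrix}_q \begin{bmatrix}M-t+c\\ c\end{bmatrix}_q \begin{bmatrix}M-t\\ n_{ac}\end{bmatrix}_q \begin{bmatrix}M-t\\ n_{bc}\end{bmatrix}_q \\ &\quad + \begin{bmatrix}L_1-t+a-1\\ a-1\end{bmatrix}_q \begin{bmatrix}L_2-t+b\\ b\end{bmatrix}_q \begin{bmatrix}L_2-t\\ n_{ab}\end{bmatrix}_q \begin{bmatrix}M-t+c\\ c\end{bmatrix}_q \begin{bmatrix}M-t\\ n_{ac}\end{bmatrix}_q \begin{bmatrix}M-t\\ n_{bc}-1\end{bmatrix}_q \Bigg\}, \end{align*} the sum being over all nonnegative integers $a,b,c,n_{ab},n_{ac},n_{bc}$ satisfying $i=a+n_{ab}+n_{ac}$, $j=b+n_{ab}+n_{bc}$, $k=c+n_{ac}+n_{bc}$, with $t=a+b+c+n_{ab}+n_{ac}+n_{bc}$; and \[ p_{i,j,k}(L_1,L_2,M):=\sum_{s\ge 0} q^{s(M+2)-T_s+T_{i-s}+T_{j-s}+T_{k-s}}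 \begin{bmatrix}L_1-s\\ i-s\end{bmatrix}_q \begin{bmatrix}L_2-i\\ j-s\end{bmatrix}_q \begin{bmatrix}L_2-i-j+s\\ s\end{bmatrix}_q \begin{bmatrix}M-i-j\\ k-s\end{bmatrix}_q . \]
   Context: $q$ is an indeterminate. For an integer $m$, $T_m=m(m+1)/2$ (so $T_{-1}=0$). For $n\ge 0$, $(x;q)_n=(x)_n=\prod_{r=0}^{n-1}(1-xq^r)$ (empty product $=1$). For integers $N,n$ the $q$-binomial coefficient is defined by $\begin{bmatrix}N\\ n\end{bmatrix}_q=\frac{(q^{N-n+1})_n}{(q)_n}$ if $n\ge 0$, and $=0$ if $n<0$ (note that $N$ may be negative, in which case the coefficient is in general nonzero). The symbols $n_{ab},n_{ac},n_{bc}$ are single integer summation variables (not products). The identity is an identity of Laurent polynomials in $q$. *)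

theory Defs
  imports
    "HOL-Computational_Algebra.Formal_Laurent_Series"
    "HOL-Library.Groups_Big_Fun"
begin

text \<open>
  The definitions are stated over an arbitrary field and an element \<open>q\<close> of it. The indeterminate
  is \<open>fls_X :: rat fls\<close>: the field of formal Laurent series contains the ring of Laurent
  polynomials in \<open>q\<close>, and the quotient defining the \<open>q\<close>-binomial coefficient is taken there.
\<close>

definition T :: "int \<Rightarrow> int" where
  "T m = m * (m + 1) div 2"

definition qpoch :: "'a::field \<Rightarrow> 'a \<Rightarrow> nat \<Rightarrow> 'a" where
  "qpoch x q n = (\<Prod>r<n. 1 - x * q ^ r)"

definition qbinom :: "'a::field \<Rightarrow> int \<Rightarrow> int \<Rightarrow> 'a" where
  "qbinom q N n =
     (if n \<ge> 0 then qpoch (q powi (N - n + 1)) q (nat n) / qpoch q q (nat n) else 0)"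

text \<open>Index tuples \<open>(a, b, c, n\<^sub>a\<^sub>b, n\<^sub>a\<^sub>c, n\<^sub>b\<^sub>c)\<close>.\<close>

definition g_index :: "int \<Rightarrow> int \<Rightarrow> int \<Rightarrow> (int \<times> int \<times> int \<times> int \<times> int \<times> int) set" where
  "g_index i j k =
     {(a, b, c, nab, nac, nbc).
        a \<ge> 0 \<and> b \<ge> 0 \<and> c \<ge> 0 \<and> nab \<ge> 0 \<and> nac \<ge> 0 \<and> nbc \<ge> 0 \<and>
        i = a + nab + nac \<and> j = b + nab + nbc \<and> k = c + nac + nbc}"

lemma finite_g_index: "finite (g_index i j k)"
proof (rule finite_subset)
  show "g_index i j k \<subseteq> {0..i} \<times> {0..j} \<times> {0..k} \<times> {0..i} \<times> {0..i} \<times> {0..j}"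
    by (auto simp: g_index_def)
qed auto

definition g_sum :: "'a::field \<Rightarrow> int \<Rightarrow> int \<Rightarrow> int \<Rightarrow> int \<Rightarrow> int \<Rightarrow> int \<Rightarrow> 'a" where
  "g_sum q i j k L1 L2 M =
     (\<Sum>(a, b, c, nab, nac, nbc)\<in>g_index i j k.
        let t = a + b + c + nab + nac + nbc in
        q powi (T t + T nab + T nac + T (nbc - 1)) *
        (q powi nbc * qbinom q (L1 - t + a) a * qbinom q (L2 - t + b) b *
           qbinom q (L2 - t) nab * qbinom q (M - t + c) c * qbinom q (M - t) nac *
           qbinom q (M - t) nbc
         + qbinom q (L1 - t + a - 1) (a - 1) * qbinom q (L2 - t + b) b *
           qbinom q (L2 - t) nab * qbinom q (M - t + c) c * qbinom q (M - t) nac *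
           qbinom q (M - t) (nbc - 1)))"

definition p_term :: "'a::field \<Rightarrow> int \<Rightarrow> int \<Rightarrow> int \<Rightarrow> int \<Rightarrow> int \<Rightarrow> int \<Rightarrow> int \<Rightarrow> 'a" where
  "p_term q i j k L1 L2 M s =
     q powi (s * (M + 2) - T s + T (i - s) + T (j - s) + T (k - s)) *
     qbinom q (L1 - s) (i - s) * qbinom q (L2 - i) (j - s) *
     qbinom q (L2 - i - j + s) s * qbinom q (M - i - j) (k - s)"

text \<open>\<^const>\<open>Sum_any\<close> is the sum over all \<open>s\<close>; the terms with \<open>s > i\<close> vanish, so the support is finite.\<close>

definition p_sum :: "'a::field \<Rightarrow> int \<Rightarrow> int \<Rightarrow> int \<Rightarrow> int \<Rightarrow> int \<Rightarrow> int \<Rightarrow> 'a" where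
  "p_sum q i j k L1 L2 M = Sum_any (\<lambda>s::nat. p_term q i j k L1 L2 M (int s))"

lemma finite_p_support: "finite {s::nat. p_term q i j k L1 L2 M (int s) \<noteq> 0}"
proof (rule finite_subset)
  show "{s::nat. p_term q i j k L1 L2 M (int s) \<noteq> 0} \<subseteq> {..nat i}"
    by (auto simp: p_term_def qbinom_def split: if_splits)
qed auto

end

theory Submission
  imports Defs
begin

text \<open>
  Both sides satisfy the same three recurrences, one in each of \<open>L1\<close>, \<open>L2\<close> and \<open>M\<close>, whose
  inhomogeneous terms have a smaller value of \<open>i + j + k\<close>. By induction the difference of the two
  sides therefore does not depend on \<open>L1\<close>, \<open>L2\<close>, \<open>M\<close>, and it is enough to exhibit, for each
  \<open>(i, j, k)\<close>, a single point where the sides agree. Unless \<open>i = j = k\<close> there is a point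
  where both sides vanish term by term; for \<open>i = j = k = n\<close> exactly one term survives on either side
  at \<open>L2 = M = 2 n\<close>.

  For the left-hand side the recurrences are termwise consequences of the Pascal rules for
  \<open>h N n = [N + n, n]\<close> and \<open>e N n = q\<^sup>T\<^sup>(\<^sup>n\<^sup>) [N, n]\<close>; for the right-hand side they hold up to a
  term that telescopes in \<open>s\<close>.
\<close>

section \<open>Triangular numbers and q-binomial coefficients at a generic q\<close>

lemma T_minus_1: "T (m - 1) = T m - m"
proof -
  have "m * (m + 1) = (m - 1) * (m - 1 + 1) + m * 2" by (simp add: algebra_simps)
  then show ?thesis unfolding T_def by simp
qed

lemma two_T: "2 * T m = m * (m + 1)"
  by (simp add: T_def)

text \<open>With \<open>q\<close> neither zero nor a root of unity, every \<open>(q;q)_n\<close> is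
  invertible and negative exponents make sense. The indeterminate is inserted only at the
  end.\<close>

locale generic_q =
  fixes q :: "'a::field"
  assumes q_nonzero [simp]: "q \<noteq> 0" and q_power_neq_1: "0 < n \<Longrightarrow> q ^ n \<noteq> 1"
begin

abbreviation qb :: "int \<Rightarrow> int \<Rightarrow> 'a" where "qb \<equiv> qbinom q"

lemma qpoch_q_nonzero: "qpoch q q n \<noteq> 0"
  using q_power_neq_1[of "Suc _"] by (auto simp: qpoch_def)

lemma powi_add: "q powi (m + n) = q powi m * q powi n"
  by (simp add: power_int_add)

lemma powi_diff: "q powi (m - n) = q powi m / q powi n"
  by (simp add: power_int_diff)

lemma powi_double: "q powi (2 * n) = q powi n * q powi n"
  by (metis mult_2 powi_add)

lemma qb_neg [simp]: "n < 0 \<Longrightarrow> qb N n = 0"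
  by (simp add: qbinom_def)

lemma qb_0 [simp]: "qb N 0 = 1"
  by (simp add: qbinom_def qpoch_def)

lemma qpoch_Suc: "qpoch x q (Suc n) = qpoch x q n * (1 - x * q ^ n)"
  by (simp add: qpoch_def)

lemma qpoch_Suc_shift: "qpoch x q (Suc n) = (1 - x) * qpoch (x * q) q n"
  by (simp add: qpoch_def prod.lessThan_Suc_shift mult.assoc del: prod.lessThan_Suc)

text \<open>The first factor of the numerator of \<open>[N, n]\<close> is split off. With the
  denominators multiplied out, the rule covers every integer \<open>n\<close>.\<close>

lemma qb_lower: "(1 - q powi n) * qb N n = (1 - q powi (N - n + 1)) * qb N (n - 1)"
proof (cases "n \<le> 0")
  case True
  then show ?thesis by (cases "n = 0") auto
next
  case False
  then obtain m where m: "n = int (Suc m)" by (metis not_less zero_less_imp_eq_int not0_implies_Suc of_nat_0_less_iff not_gr_zero)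
  have 1: "qpoch q q (Suc m) = qpoch q q m * (1 - q powi n)"
    by (simp add: qpoch_Suc m powi_add)
  have 2: "qpoch (q powi (N - n + 1)) q (Suc m) = (1 - q powi (N - n + 1)) * qpoch (q powi (N - (n-1) + 1)) q m"
    by (simp add: qpoch_Suc_shift powi_add powi_diff power2_eq_square mult_ac)
  have "1 - q powi n \<noteq> 0" using qpoch_q_nonzero[of "Suc m"] 1 by auto
  with 1 2 show ?thesis
    by (simp add: qbinom_def m nat_add_distrib)
qed

text \<open>Here the last numerator factor, \<open>1 - q powi N\<close>, is split off.\<close>

lemma qb_lower_both: "(1 - q powi n) * qb N n = (1 - q powi N) * qb (N - 1) (n - 1)"
proof (cases "n \<le> 0")
  case True
  then show ?thesis by (cases "n = 0") auto
next
  case False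
  then obtain m where m: "n = int (Suc m)" by (metis not_less zero_less_imp_eq_int not0_implies_Suc of_nat_0_less_iff not_gr_zero)
  have 1: "qpoch q q (Suc m) = qpoch q q m * (1 - q powi n)"
    by (simp add: qpoch_Suc m powi_add)
  have 2: "qpoch (q powi (N - n + 1)) q (Suc m) = (1 - q powi N) * qpoch (q powi (N - n + 1)) q m"
    by (simp add: qpoch_Suc powi_add powi_diff m)
  have "1 - q powi n \<noteq> 0" using qpoch_q_nonzero[of "Suc m"] 1 by auto
  with 1 2 show ?thesis
    by (simp add: qbinom_def m nat_add_distrib)
qed

lemma one_minus_powi_nonzero: "n > 0 \<Longrightarrow> 1 - q powi n \<noteq> 0"
  using q_power_neq_1[of "nat n"] by (auto simp: power_int_def)

text \<open>After multiplication by \<open>1 - q powi n\<close>, every term becomes a multiple of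
  \<open>qb (N - 1) (n - 1)\<close>. This also covers negative \<open>N\<close>.\<close>

lemma qb_Pascal: "qb N n = qb (N - 1) n + q powi (N - n) * qb (N - 1) (n - 1)"
proof (cases "n \<le> 0")
  case True
  then show ?thesis by (cases "n = 0") auto
next
  case False
  then have nz: "1 - q powi n \<noteq> 0" by (intro one_minus_powi_nonzero) auto
  have "(1 - q powi n) * qb N n = (1 - q powi n) * (qb (N - 1) n + q powi (N - n) * qb (N - 1) (n - 1))"
    unfolding distrib_left qb_lower_both[of n N] qb_lower[of n "N - 1"]
    by (simp add: powi_diff field_simps)
  then show ?thesis using nz by simp
qed

lemma qb_Pascal': "qb N n = q powi n * qb (N - 1) n + qb (N - 1) (n - 1)"
proof (cases "n \<le> 0")
  case True
  then show ?thesis by (cases "n = 0") auto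
next
  case False
  then have nz: "1 - q powi n \<noteq> 0" by (intro one_minus_powi_nonzero) auto
  have "(1 - q powi n) * qb N n = q powi n * ((1 - q powi n) * qb (N - 1) n) + (1 - q powi n) * qb (N - 1) (n - 1)"
    unfolding qb_lower_both[of n N] qb_lower[of n "N - 1"]
    by (simp add: powi_diff field_simps)
  also have "\<dots> = (1 - q powi n) * (q powi n * qb (N - 1) n + qb (N - 1) (n - 1))"
    by (simp add: algebra_simps)
  finally show ?thesis using nz by simp
qed

lemma qb_eq_0: assumes "0 \<le> N" "N < n" shows "qb N n = 0"
proof -
  \<comment> \<open>The numerator factor of index \<open>n - N - 1\<close> is \<open>1 - 1\<close>;
    \<open>0 \<le> N\<close> puts this index below \<open>n\<close>.\<close>
  have "nat (n - N - 1) < nat n" "q powi (N - n + 1) * q ^ nat (n - N - 1) = 1"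
    using assms powi_add[of "N - n + 1" "n - N - 1"] by (auto simp: power_int_def)
  then have "qpoch (q powi (N - n + 1)) q (nat n) = 0"
    by (auto simp: qpoch_def)
  then show ?thesis by (simp add: qbinom_def)
qed

lemma qb_self: assumes "n \<ge> 0" shows "qb n n = 1"
  using assms qpoch_q_nonzero by (simp add: qbinom_def)

section \<open>Symmetric functions of powers of q\<close>

text \<open>For \<open>N \<ge> 0\<close>, \<open>h N n\<close> is the complete homogeneous symmetric
  polynomial of degree \<open>n\<close> in \<open>1, q, ..., q^N\<close>, and \<open>e N n\<close>
  is the elementary one in \<open>q, ..., q^N\<close>.\<close>

definition h :: "int \<Rightarrow> int \<Rightarrow> 'a" where "h N n = qb (N + n) n"
definition e :: "int \<Rightarrow> int \<Rightarrow> 'a" where "e N n = q powi T n * qb N n"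

lemma h_neg [simp]: "n < 0 \<Longrightarrow> h N n = 0" and e_neg [simp]: "n < 0 \<Longrightarrow> e N n = 0"
  by (simp_all add: h_def e_def)

text \<open>In these variables, \<open>h_rec\<close> and \<open>e_rec\<close> split off the highest
  power of \<open>q\<close>; the primed rules split off the lowest one and rescale the others by
  \<open>q\<close>.\<close>

lemma h_rec: "h N n = h (N - 1) n + q powi N * h N (n - 1)"
  using qb_Pascal[of "N + n" n] by (simp add: h_def algebra_simps)

lemma h_rec': "h N n = q powi n * h (N - 1) n + h N (n - 1)"
  using qb_Pascal'[of "N + n" n] by (simp add: h_def algebra_simps)

lemma e_rec: "e N n = e (N - 1) n + q powi N * e (N - 1) (n - 1)"
  unfolding e_def qb_Pascal[of N n] T_minus_1
  by (simp add: powi_diff field_simps)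

lemma e_rec': "e N n = q powi n * (e (N - 1) n + e (N - 1) (n - 1))"
  unfolding e_def qb_Pascal'[of N n] T_minus_1
  by (simp add: powi_diff field_simps)

section \<open>Recurrences for the left-hand side\<close>

text \<open>The arguments \<open>l1\<close>, \<open>l2\<close>, \<open>m\<close> stand for
  \<open>L1 - t\<close>, \<open>L2 - t\<close>, \<open>M - t\<close>, and \<open>x\<close>,
  \<open>y\<close>, \<open>z\<close> for \<open>n_ab\<close>, \<open>n_ac\<close>,
  \<open>n_bc\<close>. Since \<open>T (z - 1) + z = T z\<close>, the factors \<open>e\<close> absorb
  all powers of \<open>q\<close> except \<open>q powi T t\<close>.\<close>

definition g_weight :: "int \<Rightarrow> int \<Rightarrow> int \<Rightarrow> int \<Rightarrow> int \<Rightarrow> int \<Rightarrow> int \<Rightarrow> int \<Rightarrow> int \<Rightarrow> 'a" where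
  "g_weight l1 l2 m a b c x y z =
     h l2 b * e l2 x * h m c * e m y * (h l1 a * e m z + h l1 (a - 1) * e m (z - 1))"

lemma g_weight_rec_l1: "g_weight l1 l2 m a b c x y z = g_weight (l1 - 1) l2 m a b c x y z + q powi l1 * g_weight l1 l2 m (a - 1) b c x y z"
  unfolding g_weight_def h_rec[of l1 a] h_rec[of l1 "a - 1"] by (simp add: algebra_simps)

lemma g_weight_rec_l2: "g_weight l1 l2 m a b c x y z = g_weight l1 (l2 - 1) m a b c x y z
   + q powi l2 * g_weight l1 l2 m a (b - 1) c x y z + q powi l2 * g_weight l1 (l2 - 1) m a b c (x - 1) y z"
proof -
  have "h l2 b * e l2 x = h (l2 - 1) b * e (l2 - 1) x + q powi l2 * (h l2 (b - 1) * e l2 x)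
     + q powi l2 * (h (l2 - 1) b * e (l2 - 1) (x - 1))"
    using h_rec[of l2 b] e_rec[of l2 x] by algebra
  then show ?thesis unfolding g_weight_def by (simp add: algebra_simps)
qed

lemma g_weight_rec_m: "g_weight l1 l2 m a b c x y z = g_weight l1 l2 (m - 1) a b c x y z
   + q powi m * g_weight l1 l2 m a b (c - 1) x y z + q powi m * g_weight l1 l2 (m - 1) a b c x (y - 1) z
   + q powi m * g_weight l1 l2 (m - 1) a b c x y (z - 1) + q powi (2 * m) * g_weight l1 l2 (m - 1) a b c x (y - 1) (z - 1)"
proof -
  \<comment> \<open>Stated for every \<open>z\<close>, because the two terms of the weight need it
    at \<open>z\<close> and at \<open>z - 1\<close>.\<close>
  have *: "h m c * e m y * e m z = h (m - 1) c * e (m - 1) y * e (m - 1) z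
     + q powi m * (h m (c - 1) * e m y * e m z)
     + q powi m * (h (m - 1) c * e (m - 1) (y - 1) * e (m - 1) z)
     + q powi m * (h (m - 1) c * e (m - 1) y * e (m - 1) (z - 1))
     + q powi (2 * m) * (h (m - 1) c * e (m - 1) (y - 1) * e (m - 1) (z - 1))" for z
  proof -
    have "h m c * e m y * e m z = h (m - 1) c * (e m y * e m z) + q powi m * (h m (c - 1) * e m y * e m z)"
      unfolding h_rec[of m c] by (simp add: algebra_simps)
    also have "e m y * e m z = (e (m - 1) y + q powi m * e (m - 1) (y - 1)) * (e (m - 1) z + q powi m * e (m - 1) (z - 1))"
      using e_rec[of m y] e_rec[of m z] by simp
    finally show ?thesis by (simp add: algebra_simps powi_double[unfolded mult.commute[of 2]])
  qed
  show ?thesis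
    using *[of z] *[of "z - 1"] unfolding g_weight_def by algebra
qed

lemma g_weight_neg: "a < 0 \<or> b < 0 \<or> c < 0 \<or> x < 0 \<or> y < 0 \<or> z < 0 \<Longrightarrow> g_weight l1 l2 m a b c x y z = 0"
  by (auto simp: g_weight_def)

definition g_summand :: "int \<Rightarrow> int \<Rightarrow> int \<Rightarrow> int \<times> int \<times> int \<times> int \<times> int \<times> int \<Rightarrow> 'a" where
  "g_summand L1 L2 M = (\<lambda>(a, b, c, x, y, z). let t = a + b + c + x + y + z in
     q powi T t * g_weight (L1 - t) (L2 - t) (M - t) a b c x y z)"

abbreviation g :: "int \<Rightarrow> int \<Rightarrow> int \<Rightarrow> int \<Rightarrow> int \<Rightarrow> int \<Rightarrow> 'a" where "g \<equiv> g_sum q"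

lemma g_eq_sum_g_summand: "g i j k L1 L2 M = sum (g_summand L1 L2 M) (g_index i j k)"
  unfolding g_sum_def
proof (rule sum.cong[OF refl], clarify)
  fix a b c x y z :: int
  show "(let t = a + b + c + x + y + z in
        q powi (T t + T x + T y + T (z - 1)) *
        (q powi z * qb (L1 - t + a) a * qb (L2 - t + b) b *
           qb (L2 - t) x * qb (M - t + c) c * qb (M - t) y * qb (M - t) z
         + qb (L1 - t + a - 1) (a - 1) * qb (L2 - t + b) b *
           qb (L2 - t) x * qb (M - t + c) c * qb (M - t) y * qb (M - t) (z - 1)))
      = g_summand L1 L2 M (a, b, c, x, y, z)"
    by (simp add: g_summand_def g_weight_def h_def e_def Let_def powi_add powi_diff T_minus_1 field_simps)
qed

lemma g_summand_neg:
  "a < 0 \<or> b < 0 \<or> c < 0 \<or> x < 0 \<or> y < 0 \<or> z < 0 \<Longrightarrow> g_summand L1 L2 M (a, b, c, x, y, z) = 0"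
  by (simp add: g_summand_def Let_def g_weight_neg)

text \<open>Tuples whose entries are at least the shift are carried bijectively onto the index set
  of the smaller triple; all others acquire a negative entry, where \<open>g_summand\<close>
  vanishes.\<close>

lemma sum_g_summand_shift:
  assumes "va \<ge> 0" "vb \<ge> 0" "vc \<ge> 0" "vx \<ge> 0" "vy \<ge> 0" "vz \<ge> 0"
  shows "(\<Sum>(a, b, c, x, y, z)\<in>g_index i j k.
            g_summand L1 L2 M (a - va, b - vb, c - vc, x - vx, y - vy, z - vz))
       = g (i - va - vx - vy) (j - vb - vx - vz) (k - vc - vy - vz) L1 L2 M"
  unfolding g_eq_sum_g_summand
  by (rule sum.reindex_bij_witness_not_neutral[where T' = "{}" and
        S' = "{(a, b, c, x, y, z) \<in> g_index i j k. a < va \<or> b < vb \<or> c < vc \<or> x < vx \<or> y < vy \<or> z < vz}"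
        and i = "\<lambda>(a, b, c, x, y, z). (a + va, b + vb, c + vc, x + vx, y + vy, z + vz)"
        and j = "\<lambda>(a, b, c, x, y, z). (a - va, b - vb, c - vc, x - vx, y - vy, z - vz)"])
     (use assms in \<open>auto simp: g_index_def g_summand_neg intro: finite_subset[OF _ finite_g_index]\<close>)

lemma g_summand_eq:
  assumes "a + b + c + x + y + z = t" "L1 = l1 + t" "L2 = l2 + t" "M = m + t"
  shows "g_summand L1 L2 M (a, b, c, x, y, z) = q powi T t * g_weight l1 l2 m a b c x y z"
  using assms by (simp add: g_summand_def Let_def)

text \<open>Lowering one index lowers \<open>t\<close> by one. The factor
  \<open>q powi (L - t)\<close> from a Pascal rule turns \<open>T t\<close> into
  \<open>T (t - 1)\<close> and leaves a power free of \<open>t\<close>.\<close>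

lemma powi_T_shift: "q powi T t * q powi (L - t) = q powi L * q powi T (t - 1)"
  by (simp add: T_minus_1 powi_diff)

text \<open>To keep \<open>L1 - t\<close>, \<open>L2 - t\<close> and \<open>M - t\<close> fixed
  while \<open>t\<close> drops by one, all three parameters drop by one in the inhomogeneous
  term.\<close>

lemma g_rec_L1: "g i j k L1 L2 M = g i j k (L1 - 1) L2 M + q powi L1 * g (i - 1) j k (L1 - 1) (L2 - 1) (M - 1)"
proof -
  \<comment> \<open>The subtractions of \<open>0\<close> keep the pattern of
    \<open>sum_g_summand_shift\<close>.\<close>
  have "g_summand L1 L2 M (a, b, c, x, y, z) = g_summand (L1 - 1) L2 M (a, b, c, x, y, z)
      + q powi L1 * g_summand (L1 - 1) (L2 - 1) (M - 1) (a - 1, b - 0, c - 0, x - 0, y - 0, z - 0)" for a b c x y z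
  proof -
    define t where "t = a + b + c + x + y + z"
    have "g_summand L1 L2 M (a, b, c, x, y, z) = q powi T t * g_weight (L1 - t) (L2 - t) (M - t) a b c x y z"
         "g_summand (L1 - 1) L2 M (a, b, c, x, y, z) = q powi T t * g_weight (L1 - t - 1) (L2 - t) (M - t) a b c x y z"
         "g_summand (L1 - 1) (L2 - 1) (M - 1) (a - 1, b - 0, c - 0, x - 0, y - 0, z - 0) =
            q powi T (t - 1) * g_weight (L1 - t) (L2 - t) (M - t) (a - 1) b c x y z"
      by (simp_all add: g_summand_eq t_def)
    then show ?thesis
      using g_weight_rec_l1[of "L1 - t" "L2 - t" "M - t" a b c x y z] powi_T_shift[of t L1] by algebra
  qed
  then have "g i j k L1 L2 M = (\<Sum>(a, b, c, x, y, z)\<in>g_index i j k. g_summand (L1 - 1) L2 M (a, b, c, x, y, z)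
      + q powi L1 * g_summand (L1 - 1) (L2 - 1) (M - 1) (a - 1, b - 0, c - 0, x - 0, y - 0, z - 0))"
    unfolding g_eq_sum_g_summand by (intro sum.cong) auto
  also have "\<dots> = g i j k (L1 - 1) L2 M + q powi L1 * g (i - 1 - 0 - 0) (j - 0 - 0 - 0) (k - 0 - 0 - 0) (L1 - 1) (L2 - 1) (M - 1)"
    by (subst sum_g_summand_shift[symmetric]) (simp_all add: g_eq_sum_g_summand case_prod_unfold sum.distrib sum_distrib_left)
  finally show ?thesis by simp
qed

text \<open>In \<open>e_rec\<close>, lowering \<open>x\<close> also lowers \<open>l2\<close>;
  together with the drop of \<open>t\<close> this gives \<open>L2 - 2\<close> in the last
  term.\<close>

lemma g_rec_L2:
  "g i j k L1 L2 M = g i j k L1 (L2 - 1) M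
     + q powi L2 * g i (j - 1) k (L1 - 1) (L2 - 1) (M - 1)
     + q powi L2 * g (i - 1) (j - 1) k (L1 - 1) (L2 - 2) (M - 1)"
proof -
  have "g_summand L1 L2 M (a, b, c, x, y, z) = g_summand L1 (L2 - 1) M (a, b, c, x, y, z)
      + q powi L2 * g_summand (L1 - 1) (L2 - 1) (M - 1) (a - 0, b - 1, c - 0, x - 0, y - 0, z - 0)
      + q powi L2 * g_summand (L1 - 1) (L2 - 2) (M - 1) (a - 0, b - 0, c - 0, x - 1, y - 0, z - 0)" for a b c x y z
  proof -
    define t where "t = a + b + c + x + y + z"
    have "g_summand L1 L2 M (a, b, c, x, y, z) = q powi T t * g_weight (L1 - t) (L2 - t) (M - t) a b c x y z"
         "g_summand L1 (L2 - 1) M (a, b, c, x, y, z) = q powi T t * g_weight (L1 - t) (L2 - t - 1) (M - t) a b c x y z"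
         "g_summand (L1 - 1) (L2 - 1) (M - 1) (a - 0, b - 1, c - 0, x - 0, y - 0, z - 0) =
            q powi T (t - 1) * g_weight (L1 - t) (L2 - t) (M - t) a (b - 1) c x y z"
         "g_summand (L1 - 1) (L2 - 2) (M - 1) (a - 0, b - 0, c - 0, x - 1, y - 0, z - 0) =
            q powi T (t - 1) * g_weight (L1 - t) (L2 - t - 1) (M - t) a b c (x - 1) y z"
      by (simp_all add: g_summand_eq t_def)
    then show ?thesis
      using g_weight_rec_l2[of "L1 - t" "L2 - t" "M - t" a b c x y z] powi_T_shift[of t L2] by algebra
  qed
  then have "g i j k L1 L2 M = (\<Sum>(a, b, c, x, y, z)\<in>g_index i j k. g_summand L1 (L2 - 1) M (a, b, c, x, y, z)
      + q powi L2 * g_summand (L1 - 1) (L2 - 1) (M - 1) (a - 0, b - 1, c - 0, x - 0, y - 0, z - 0)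
      + q powi L2 * g_summand (L1 - 1) (L2 - 2) (M - 1) (a - 0, b - 0, c - 0, x - 1, y - 0, z - 0))"
    unfolding g_eq_sum_g_summand by (intro sum.cong) auto
  also have "\<dots> = g i j k L1 (L2 - 1) M
      + q powi L2 * g (i - 0 - 0 - 0) (j - 1 - 0 - 0) (k - 0 - 0 - 0) (L1 - 1) (L2 - 1) (M - 1)
      + q powi L2 * g (i - 0 - 1 - 0) (j - 0 - 1 - 0) (k - 0 - 0 - 0) (L1 - 1) (L2 - 2) (M - 1)"
    by (subst (1 2) sum_g_summand_shift[symmetric]) (simp_all add: g_eq_sum_g_summand case_prod_unfold sum.distrib sum_distrib_left)
  finally show ?thesis by simp
qed

lemma g_rec_M:
  "g i j k L1 L2 M = g i j k L1 L2 (M - 1)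
     + q powi M * g i j (k - 1) (L1 - 1) (L2 - 1) (M - 1)
     + q powi M * g (i - 1) j (k - 1) (L1 - 1) (L2 - 1) (M - 2)
     + q powi M * g i (j - 1) (k - 1) (L1 - 1) (L2 - 1) (M - 2)
     + q powi (2 * M - 1) * g (i - 1) (j - 1) (k - 2) (L1 - 2) (L2 - 2) (M - 3)"
proof -
  have "g_summand L1 L2 M (a, b, c, x, y, z) = g_summand L1 L2 (M - 1) (a, b, c, x, y, z)
      + q powi M * g_summand (L1 - 1) (L2 - 1) (M - 1) (a - 0, b - 0, c - 1, x - 0, y - 0, z - 0)
      + q powi M * g_summand (L1 - 1) (L2 - 1) (M - 2) (a - 0, b - 0, c - 0, x - 0, y - 1, z - 0)
      + q powi M * g_summand (L1 - 1) (L2 - 1) (M - 2) (a - 0, b - 0, c - 0, x - 0, y - 0, z - 1)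
      + q powi (2 * M - 1) * g_summand (L1 - 2) (L2 - 2) (M - 3) (a - 0, b - 0, c - 0, x - 0, y - 1, z - 1)" for a b c x y z
  proof -
    define t where "t = a + b + c + x + y + z"
    have "g_summand L1 L2 M (a, b, c, x, y, z) = q powi T t * g_weight (L1 - t) (L2 - t) (M - t) a b c x y z"
         "g_summand L1 L2 (M - 1) (a, b, c, x, y, z) = q powi T t * g_weight (L1 - t) (L2 - t) (M - t - 1) a b c x y z"
         "g_summand (L1 - 1) (L2 - 1) (M - 1) (a - 0, b - 0, c - 1, x - 0, y - 0, z - 0) =
            q powi T (t - 1) * g_weight (L1 - t) (L2 - t) (M - t) a b (c - 1) x y z"
         "g_summand (L1 - 1) (L2 - 1) (M - 2) (a - 0, b - 0, c - 0, x - 0, y - 1, z - 0) =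
            q powi T (t - 1) * g_weight (L1 - t) (L2 - t) (M - t - 1) a b c x (y - 1) z"
         "g_summand (L1 - 1) (L2 - 1) (M - 2) (a - 0, b - 0, c - 0, x - 0, y - 0, z - 1) =
            q powi T (t - 1) * g_weight (L1 - t) (L2 - t) (M - t - 1) a b c x y (z - 1)"
         "g_summand (L1 - 2) (L2 - 2) (M - 3) (a - 0, b - 0, c - 0, x - 0, y - 1, z - 1) =
            q powi T (t - 1 - 1) * g_weight (L1 - t) (L2 - t) (M - t - 1) a b c x (y - 1) (z - 1)"
      by (simp_all add: g_summand_eq t_def)
    \<comment> \<open>Lowering \<open>y\<close> and \<open>z\<close> together lowers
      \<open>t\<close> by two; the \<open>- 1\<close> in the exponent comes from
      \<open>T t - T (t - 2) = 2 * t - 1\<close>.\<close>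
    moreover have "q powi T t * q powi (2 * (M - t)) = q powi (2 * M - 1) * q powi T (t - 1 - 1)"
      unfolding T_minus_1 powi_add[symmetric] by (simp add: algebra_simps)
    ultimately show ?thesis
      using g_weight_rec_m[of "L1 - t" "L2 - t" "M - t" a b c x y z] powi_T_shift[of t M] by algebra
  qed
  then have "g i j k L1 L2 M = (\<Sum>(a, b, c, x, y, z)\<in>g_index i j k. g_summand L1 L2 (M - 1) (a, b, c, x, y, z)
      + q powi M * g_summand (L1 - 1) (L2 - 1) (M - 1) (a - 0, b - 0, c - 1, x - 0, y - 0, z - 0)
      + q powi M * g_summand (L1 - 1) (L2 - 1) (M - 2) (a - 0, b - 0, c - 0, x - 0, y - 1, z - 0)
      + q powi M * g_summand (L1 - 1) (L2 - 1) (M - 2) (a - 0, b - 0, c - 0, x - 0, y - 0, z - 1)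
      + q powi (2 * M - 1) * g_summand (L1 - 2) (L2 - 2) (M - 3) (a - 0, b - 0, c - 0, x - 0, y - 1, z - 1))"
    unfolding g_eq_sum_g_summand by (intro sum.cong) auto
  also have "\<dots> = g i j k L1 L2 (M - 1)
     + q powi M * g (i - 0 - 0 - 0) (j - 0 - 0 - 0) (k - 1 - 0 - 0) (L1 - 1) (L2 - 1) (M - 1)
     + q powi M * g (i - 0 - 0 - 1) (j - 0 - 0 - 0) (k - 0 - 1 - 0) (L1 - 1) (L2 - 1) (M - 2)
     + q powi M * g (i - 0 - 0 - 0) (j - 0 - 0 - 1) (k - 0 - 0 - 1) (L1 - 1) (L2 - 1) (M - 2)
     + q powi (2 * M - 1) * g (i - 0 - 0 - 1) (j - 0 - 0 - 1) (k - 0 - 1 - 1) (L1 - 2) (L2 - 2) (M - 3)"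
    by (subst (1 2 3 4) sum_g_summand_shift[symmetric]) (simp_all add: g_eq_sum_g_summand case_prod_unfold sum.distrib sum_distrib_left)
  finally show ?thesis by simp
qed

section \<open>Recurrences for the right-hand side\<close>

text \<open>
  The multinomial factor \<open>[N, j - s] [N - j + s, s]\<close> of \<open>p\<close>, up to a power of \<open>q\<close>. The two recurrences
  remove one letter from a multinomial coefficient, for two different orders of the letters.
\<close>

definition V :: "int \<Rightarrow> int \<Rightarrow> int \<Rightarrow> 'a" where "V N j s = e N (j - s) * h (N - j) s"

lemma V_neg: "s < 0 \<Longrightarrow> V N j s = 0"
  by (simp add: V_def)

lemma V_rec: "V N j s = V (N - 1) j s + q powi (N - j) * V (N - 1) (j - 1) (s - 1) + q powi N * V (N - 1) (j - 1) s"
proof -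
  have "V (N - 1) j s = e (N - 1) (j - s) * h (N - j - 1) s"
       "V (N - 1) (j - 1) (s - 1) = e (N - 1) (j - s) * h (N - j) (s - 1)"
       "V (N - 1) (j - 1) s = e (N - 1) (j - s - 1) * h (N - j) s"
    by (simp_all add: V_def algebra_simps)
  then show ?thesis
    using e_rec[of N "j - s"] h_rec[of "N - j" s] unfolding V_def by algebra
qed

lemma V_rec': "V N j s = q powi j * V (N - 1) j s + q powi (j - s) * (V (N - 1) (j - 1) (s - 1) + V (N - 1) (j - 1) s)"
proof -
  have "V (N - 1) j s = e (N - 1) (j - s) * h (N - j - 1) s"
       "V (N - 1) (j - 1) (s - 1) = e (N - 1) (j - s) * h (N - j) (s - 1)"
       "V (N - 1) (j - 1) s = e (N - 1) (j - s - 1) * h (N - j) s"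
       "q powi j = q powi (j - s) * q powi s"
    by (simp_all add: V_def algebra_simps flip: powi_add)
  then show ?thesis
    using e_rec'[of N "j - s"] h_rec'[of "N - j" s] unfolding V_def by algebra
qed

text \<open>\<open>qb_lower\<close> and \<open>qb_lower_both\<close> bring in the same factor
  \<open>1 - q powi (N - j + s + 1)\<close>, one for each binomial coefficient, so they link up
  without division. This serves the telescoping in \<open>p_rec_M\<close>.\<close>

lemma V_step: "(q powi (s + 1) - 1) * V N j (s + 1) = (1 - q powi (s - j)) * V N j s"
proof -
  have 1: "(1 - q powi (j - s)) * qb N (j - s) = (1 - q powi (N - j + s + 1)) * qb N (j - s - 1)"
    using qb_lower[of "j - s" N] by (simp add: algebra_simps)
  have 2: "(1 - q powi (s + 1)) * qb (N - j + s + 1) (s + 1) = (1 - q powi (N - j + s + 1)) * qb (N - j + s) s"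
    using qb_lower_both[of "s + 1" "N - j + s + 1"] by simp
  have V1: "V N j (s + 1) = q powi T (j - s - 1) * qb N (j - s - 1) * qb (N - j + s + 1) (s + 1)"
    by (simp add: V_def e_def h_def algebra_simps)
  have V0: "V N j s = q powi T (j - s) * qb N (j - s) * qb (N - j + s) s"
    by (simp add: V_def e_def h_def)
  have 3: "q powi T (j - s) = q powi T (j - s - 1) * q powi (j - s)"
    by (simp add: T_minus_1 powi_diff)
  have 4: "q powi (s - j) * q powi (j - s) = 1"
    by (simp flip: powi_add)
  show ?thesis unfolding V1 V0 3 using 1 2 4 by algebra
qed

text \<open>The part of the exponent in \<open>p_term\<close> that the factors \<open>e\<close> and
  \<open>V\<close> do not absorb.\<close>

definition w :: "int \<Rightarrow> int \<Rightarrow> 'a" where "w M s = q powi (s * (M + 2) - T s)"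

lemma w_M_minus_1: "w (M - 1) s = w M s / q powi s"
  unfolding w_def powi_diff[symmetric] by (simp add: algebra_simps)

lemma w_s_plus_1: "w M (s + 1) = q powi (M + 1 - s) * w M s"
proof -
  have "T (s + 1) = T s + s + 1" using T_minus_1[of "s + 1"] by simp
  then show ?thesis unfolding w_def powi_add[symmetric] by (simp add: algebra_simps)
qed

abbreviation p :: "int \<Rightarrow> int \<Rightarrow> int \<Rightarrow> int \<Rightarrow> int \<Rightarrow> int \<Rightarrow> 'a" where "p \<equiv> p_sum q"

definition p_summand :: "int \<Rightarrow> int \<Rightarrow> int \<Rightarrow> int \<Rightarrow> int \<Rightarrow> int \<Rightarrow> int \<Rightarrow> 'a" where
  "p_summand i j k L1 L2 M s = w M s * e (L1 - s) (i - s) * V (L2 - i) j s * e (M - i - j) (k - s)"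

lemma p_term_eq_p_summand: "p_term q i j k L1 L2 M s = p_summand i j k L1 L2 M s"
  by (simp add: p_term_def p_summand_def w_def V_def e_def h_def powi_add powi_diff)

lemma p_summand_neg: "s < 0 \<or> i < s \<or> j < s \<or> k < s \<Longrightarrow> p_summand i j k L1 L2 M s = 0"
  by (auto simp: p_summand_def V_def)

text \<open>Additional terms vanish, so the bounds are free: sums for different triples can share
  one range, and a range starting at \<open>-1\<close> suits the telescoping.\<close>

lemma p_eq_sum_p_summand:
  assumes "lo \<le> 0" "i \<le> hi"
  shows "p i j k L1 L2 M = (\<Sum>s = lo..hi. p_summand i j k L1 L2 M s)"
proof -
  have "p i j k L1 L2 M = (\<Sum>s | p_term q i j k L1 L2 M (int s) \<noteq> 0. p_term q i j k L1 L2 M (int s))"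
    by (simp add: p_sum_def Sum_any.expand_set)
  also have "\<dots> = (\<Sum>s = lo..hi. p_summand i j k L1 L2 M s)"
  proof (rule sum.reindex_bij_witness_not_neutral[where S' = "{}" and i = nat and j = int and
        T' = "{s \<in> {lo..hi}. p_summand i j k L1 L2 M s = 0}"])
    fix s assume "s \<in> {s. p_term q i j k L1 L2 M (int s) \<noteq> 0} - {}"
    then have nz: "p_summand i j k L1 L2 M (int s) \<noteq> 0" by (simp add: p_term_eq_p_summand)
    then have "int s \<le> i" using p_summand_neg[of "int s" i] by force
    with nz assms show "int s \<in> {lo..hi} - {s \<in> {lo..hi}. p_summand i j k L1 L2 M s = 0}" by auto
  next
    fix s assume "s \<in> {lo..hi} - {s \<in> {lo..hi}. p_summand i j k L1 L2 M s = 0}"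
    then have nz: "p_summand i j k L1 L2 M s \<noteq> 0" by auto
    then have "s \<ge> 0" using p_summand_neg[of s i] by force
    then show "int (nat s) = s" by simp
    with nz show "nat s \<in> {s. p_term q i j k L1 L2 M (int s) \<noteq> 0} - {}"
      by (simp add: p_term_eq_p_summand)
  next
    show "finite {s \<in> {lo..hi}. p_summand i j k L1 L2 M s = 0}"
      by (rule finite_subset[of _ "{lo..hi}"]) auto
  qed (auto simp: p_term_eq_p_summand)
  finally show ?thesis .
qed

lemma p_neg: "i < 0 \<or> j < 0 \<or> k < 0 \<Longrightarrow> p i j k L1 L2 M = 0"
  by (subst p_eq_sum_p_summand[of 0 _ i]) (auto intro!: sum.neutral p_summand_neg)

text \<open>After a shift of the index, the two sums can differ only by the end terms
  \<open>H (-1)\<close> and \<open>H (i + 2)\<close>.\<close>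

lemma sum_telescope_int:
  fixes H :: "int \<Rightarrow> 'a"
  assumes "H (-1) = 0" "H (i + 2) = 0"
  shows "(\<Sum>s = -1..i + 1. H s - H (s + 1)) = 0"
proof -
  have "(\<Sum>s = -1..i + 1. H (s + 1)) = (\<Sum>s = -1..i + 1. H s)"
    by (rule sum.reindex_bij_witness_not_neutral[where S' = "{i + 1} \<inter> {-1..i + 1}" and T' = "{-1} \<inter> {-1..i + 1}"
          and i = "\<lambda>s. s - 1" and j = "\<lambda>s. s + 1"])
       (use assms in \<open>auto simp: add.assoc\<close>)
  then show ?thesis by (simp add: sum_subtractf)
qed

text \<open>This is \<open>e_rec\<close> termwise: \<open>L2 - i\<close> and
  \<open>M - i - j\<close> do not change, and replacing \<open>w M s\<close> by
  \<open>w (M - 1) s\<close> accounts for the \<open>- s\<close> in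
  \<open>q powi (L1 - s)\<close>.\<close>

lemma p_rec_L1: "p i j k L1 L2 M = p i j k (L1 - 1) L2 M + q powi L1 * p (i - 1) j k (L1 - 1) (L2 - 1) (M - 1)"
proof -
  have "p_summand i j k L1 L2 M s = p_summand i j k (L1 - 1) L2 M s + q powi L1 * p_summand (i - 1) j k (L1 - 1) (L2 - 1) (M - 1) s" for s
  proof -
    have "p_summand i j k (L1 - 1) L2 M s = w M s * e (L1 - s - 1) (i - s) * V (L2 - i) j s * e (M - i - j) (k - s)"
         "p_summand (i - 1) j k (L1 - 1) (L2 - 1) (M - 1) s
            = w (M - 1) s * e (L1 - s - 1) (i - s - 1) * V (L2 - i) j s * e (M - i - j) (k - s)"
      by (simp_all add: p_summand_def algebra_simps)
    moreover have "q powi L1 * w (M - 1) s = q powi (L1 - s) * w M s"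
      by (simp add: w_M_minus_1 powi_diff)
    ultimately show ?thesis using e_rec[of "L1 - s" "i - s"] unfolding p_summand_def by algebra
  qed
  then show ?thesis
    by (simp add: p_eq_sum_p_summand[of 0 _ i] sum.distrib sum_distrib_left)
qed

lemma p_rec_L2:
  "p i j k L1 L2 M = p i j k L1 (L2 - 1) M
     + q powi L2 * p i (j - 1) k (L1 - 1) (L2 - 1) (M - 1)
     + q powi L2 * p (i - 1) (j - 1) k (L1 - 1) (L2 - 2) (M - 1)"
proof -
  define N m where "N = L2 - i" and "m = M - i - j"
  \<comment> \<open>\<open>H s\<close> is the contribution of the middle term of
    \<open>V_rec\<close>. Expanding \<open>e (m + 1) (k - s)\<close> in the last inhomogeneous term
    gives a surplus equal to \<open>H (s + 1)\<close>.\<close>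
  define H where "H s = q powi (N - j) * w M s * e (L1 - s) (i - s) * e m (k - s) * V (N - 1) (j - 1) (s - 1)" for s
  have "p_summand i j k L1 L2 M s = p_summand i j k L1 (L2 - 1) M s
     + q powi L2 * p_summand i (j - 1) k (L1 - 1) (L2 - 1) (M - 1) s
     + q powi L2 * p_summand (i - 1) (j - 1) k (L1 - 1) (L2 - 2) (M - 1) s + (H s - H (s + 1))" for s
  proof -
    have pts: "p_summand i j k L1 L2 M s = w M s * e (L1 - s) (i - s) * V N j s * e m (k - s)"
      "p_summand i j k L1 (L2 - 1) M s = w M s * e (L1 - s) (i - s) * V (N - 1) j s * e m (k - s)"
      "p_summand i (j - 1) k (L1 - 1) (L2 - 1) (M - 1) s
          = w (M - 1) s * e (L1 - s - 1) (i - s) * V (N - 1) (j - 1) s * e m (k - s)"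
      "p_summand (i - 1) (j - 1) k (L1 - 1) (L2 - 2) (M - 1) s
          = w (M - 1) s * e (L1 - s - 1) (i - s - 1) * V (N - 1) (j - 1) s * e (m + 1) (k - s)"
      by (simp_all add: p_summand_def N_def m_def algebra_simps)
    have H1: "H (s + 1) = q powi (N - j) * w M (s + 1) * e (L1 - s - 1) (i - s - 1) * e m (k - s - 1) * V (N - 1) (j - 1) s"
      by (simp add: H_def algebra_simps)
    have em: "e (m + 1) (k - s) = e m (k - s) + q powi (m + 1) * e m (k - s - 1)"
      using e_rec[of "m + 1" "k - s"] by simp
    have w2: "q powi (N - j) * w M (s + 1) = q powi L2 * w (M - 1) s * q powi (m + 1)"
      unfolding w_M_minus_1 w_s_plus_1 by (simp add: powi_diff powi_add N_def m_def mult_ac)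
    have w3: "q powi N * w M s * q powi (i - s) = q powi L2 * w (M - 1) s"
      by (simp add: w_M_minus_1 powi_diff N_def)
    \<comment> \<open>The primed rule splits the remaining term into the two inhomogeneous ones,
      with \<open>i\<close> kept and with \<open>i\<close> lowered.\<close>
    have U: "q powi N * w M s * e (L1 - s) (i - s)
        = q powi L2 * w (M - 1) s * (e (L1 - s - 1) (i - s) + e (L1 - s - 1) (i - s - 1))"
      unfolding e_rec'[of "L1 - s" "i - s"] w3[symmetric] by (simp add: mult_ac)
    have "p_summand i j k L1 L2 M s = p_summand i j k L1 (L2 - 1) M s + H s
        + q powi N * w M s * e (L1 - s) (i - s) * V (N - 1) (j - 1) s * e m (k - s)"
      unfolding pts H_def V_rec[of N j s] by (simp add: algebra_simps)
    then show ?thesis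
      unfolding U pts(3,4) H1 em w2 by (simp add: algebra_simps)
  qed
  moreover have "(\<Sum>s = -1..i + 1. H s - H (s + 1)) = 0"
    by (rule sum_telescope_int) (simp_all add: H_def V_neg)
  ultimately show ?thesis
    by (simp add: p_eq_sum_p_summand[of "-1" _ "i + 1"] sum.distrib sum_distrib_left)
qed

lemma p_rec_M:
  "p i j k L1 L2 M = p i j k L1 L2 (M - 1)
     + q powi M * p i j (k - 1) (L1 - 1) (L2 - 1) (M - 1)
     + q powi M * p (i - 1) j (k - 1) (L1 - 1) (L2 - 1) (M - 2)
     + q powi M * p i (j - 1) (k - 1) (L1 - 1) (L2 - 1) (M - 2)
     + q powi (2 * M - 1) * p (i - 1) (j - 1) (k - 2) (L1 - 2) (L2 - 2) (M - 3)"
proof -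
  define N m where "N = L2 - i" and "m = M - i - j"
  define R where "R s = q powi (2 * M - 1) * p_summand (i - 1) (j - 1) (k - 2) (L1 - 2) (L2 - 2) (M - 3) s" for s
  \<comment> \<open>The first part of \<open>H s\<close> is the portion of the difference between
    the summands at \<open>M\<close> and \<open>M - 1\<close> that carries
    \<open>e (m - 1) (k - s)\<close>. Once \<open>R s\<close> cancels inside
    \<open>H (s + 1)\<close>, all other terms carry \<open>e (m - 1) (k - s - 1)\<close>; the last
    recurrence term then enters at \<open>s - 1\<close>.\<close>
  define H where "H s = w M s * V N j s * e (L1 - s) (i - s) * (1 - q powi (- s)) * e (m - 1) (k - s) + R (s - 1)" for s
  have "p_summand i j k L1 L2 M s = p_summand i j k L1 L2 (M - 1) s
     + q powi M * p_summand i j (k - 1) (L1 - 1) (L2 - 1) (M - 1) s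
     + q powi M * p_summand (i - 1) j (k - 1) (L1 - 1) (L2 - 1) (M - 2) s
     + q powi M * p_summand i (j - 1) (k - 1) (L1 - 1) (L2 - 1) (M - 2) s + R s + (H s - H (s + 1))" for s
  proof -
    \<comment> \<open>In these quantities and the values of \<open>V\<close> and \<open>w\<close>
      below, the termwise identity becomes one of rational functions, settled by field
      arithmetic.\<close>
    define A B C D where "A = e (L1 - s - 1) (i - s)" and "B = e (L1 - s - 1) (i - s - 1)"
      and "C = e (m - 1) (k - s)" and "D = e (m - 1) (k - s - 1)"
    define Qi Qj QM Qs where "Qi = q powi i" and "Qj = q powi j" and "QM = q powi M" and "Qs = q powi s"
    note Q = Qi_def[symmetric] Qj_def[symmetric] QM_def[symmetric] Qs_def[symmetric]
    have nz: "Qi \<noteq> 0" "Qj \<noteq> 0" "QM \<noteq> 0" "Qs \<noteq> 0" by (simp_all add: Qi_def Qj_def QM_def Qs_def)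
    have w1: "w (M - 1) s = w M s / Qs" and w2: "w (M - 2) s = w M s / Qs\<^sup>2"
      using w_M_minus_1[of M s] w_M_minus_1[of "M - 1" s] by (simp_all add: Q power2_eq_square)
    have w3: "w M (s + 1) = QM * q / Qs * w M s"
      by (simp add: w_s_plus_1 powi_add powi_diff Q)
    have w4: "w (M - 3) (s - 1) = w M s * q / (QM * Qs\<^sup>2)"
    proof -
      have "w (M - 3) (s - 1) = q powi (s * (M + 2) - T s + 1 - M - 2 * s)"
        by (simp add: w_def T_minus_1 algebra_simps)
      then show ?thesis
        by (simp add: w_def powi_add powi_diff powi_double Q power2_eq_square)
    qed
    have U: "e (L1 - s) (i - s) = Qi / Qs * (A + B)"
      using e_rec'[of "L1 - s" "i - s"] by (simp add: A_def B_def powi_diff Q)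
    have em: "e m (k - s) = C + QM / (Qi * Qj) * D"
      using e_rec[of m "k - s"] by (simp add: C_def D_def m_def powi_diff Q)
    define V0 V2 V3 where "V0 = V N j s" and "V2 = V (N - 1) (j - 1) s" and "V3 = V (N - 1) (j - 1) (s - 1)"
    \<comment> \<open>\<open>V_rec'\<close> solved for \<open>V (N - 1) j s\<close>, so that only
      \<open>V0\<close>, \<open>V2\<close> and \<open>V3\<close> remain.\<close>
    have V1: "V (N - 1) j s = V0 / Qj - (V2 + V3) / Qs"
      using V_rec'[of N j s] nz unfolding V0_def[symmetric] V2_def[symmetric] V3_def[symmetric]
      by (simp add: powi_diff Q field_simps)
    have V': "(Qs * q - 1) * V N j (s + 1) = (1 - Qs / Qj) * V0"
      using V_step[of s N j] by (simp add: powi_diff powi_add Q V0_def)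
    have R': "R (s - 1) = QM / Qs\<^sup>2 * w M s * A * V3 * D"
    proof -
      have "R (s - 1) = q powi (2 * M - 1) * (w (M - 3) (s - 1) * A * V3 * D)"
        unfolding R_def p_summand_def A_def V3_def D_def N_def m_def by (simp add: algebra_simps)
      also have "q powi (2 * M - 1) = QM * QM / q"
        by (simp add: powi_diff powi_double Q)
      finally show ?thesis using nz by (simp add: w4)
    qed
    have Hs: "H s = w M s * V0 * (Qi / Qs * (A + B)) * (1 - 1 / Qs) * C + QM / Qs\<^sup>2 * w M s * A * V3 * D"
      unfolding H_def R' U C_def[symmetric] V0_def[symmetric] using nz
      by (simp add: power_int_minus Q divide_inverse)
    have "H (s + 1) = w M (s + 1) * V N j (s + 1) * B * (1 - q powi (- 1 - s)) * D + R s"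
      by (simp add: H_def B_def D_def algebra_simps)
    also have "w M (s + 1) * V N j (s + 1) * B * (1 - q powi (- 1 - s)) * D
        = QM / Qs\<^sup>2 * w M s * ((Qs * q - 1) * V N j (s + 1)) * B * D"
      unfolding w3 using nz by (simp add: powi_diff power_int_minus Q field_simps power2_eq_square)
    finally have Hs1: "H (s + 1) = QM / Qs\<^sup>2 * w M s * ((1 - Qs / Qj) * V0) * B * D + R s"
      unfolding V' .
    have pts: "p_summand i j k L1 L2 M s = w M s * (Qi / Qs * (A + B)) * V0 * (C + QM / (Qi * Qj) * D)"
      "p_summand i j k L1 L2 (M - 1) s = w M s / Qs * (Qi / Qs * (A + B)) * V0 * C"
      "p_summand i j (k - 1) (L1 - 1) (L2 - 1) (M - 1) s = w M s / Qs * A * (V0 / Qj - (V2 + V3) / Qs) * D"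
      "p_summand (i - 1) j (k - 1) (L1 - 1) (L2 - 1) (M - 2) s = w M s / Qs\<^sup>2 * B * V0 * D"
      "p_summand i (j - 1) (k - 1) (L1 - 1) (L2 - 1) (M - 2) s = w M s / Qs\<^sup>2 * A * V2 * D"
      unfolding U[symmetric] em[symmetric] w1[symmetric] w2[symmetric] V1[symmetric]
      unfolding p_summand_def A_def B_def C_def D_def V0_def V2_def N_def m_def
      by (simp_all add: algebra_simps)
    show ?thesis
      unfolding pts Hs Hs1 Q using nz by (simp add: field_simps power2_eq_square)
  qed
  moreover have "(\<Sum>s = -1..i + 1. H s - H (s + 1)) = 0"
    by (rule sum_telescope_int) (simp_all add: H_def R_def V_neg p_summand_neg)
  moreover have "(\<Sum>s = -1..i + 1. R s) = q powi (2 * M - 1) * p (i - 1) (j - 1) (k - 2) (L1 - 2) (L2 - 2) (M - 3)"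
    by (simp add: R_def p_eq_sum_p_summand[of "-1" _ "i + 1"] sum_distrib_left)
  ultimately show ?thesis
    by (simp add: p_eq_sum_p_summand[of "-1" _ "i + 1"] sum.distrib sum_distrib_left)
qed

section \<open>Supports of the summands and points of agreement\<close>

lemma g_neg: "i < 0 \<or> j < 0 \<or> k < 0 \<Longrightarrow> g i j k L1 L2 M = 0"
  unfolding g_eq_sum_g_summand by (intro sum.neutral) (auto simp: g_index_def)

lemma h_nonzeroD: "h N n \<noteq> 0 \<Longrightarrow> 0 \<le> N + n \<Longrightarrow> 0 \<le> N"
  using qb_eq_0[of "N + n" n] by (force simp: h_def)

lemma e_nonzeroD: "e N n \<noteq> 0 \<Longrightarrow> 0 \<le> N \<Longrightarrow> n \<le> N"
  using qb_eq_0[of N n] by (force simp: e_def)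

lemma g_summand_nonzeroD:
  assumes "g_summand L1 L2 M (a, b, c, x, y, z) \<noteq> 0" and "t = a + b + c + x + y + z"
  shows "h (L2 - t) b \<noteq> 0" "e (L2 - t) x \<noteq> 0" "h (M - t) c \<noteq> 0" "e (M - t) y \<noteq> 0"
    "h (L1 - t) a \<noteq> 0 \<and> e (M - t) z \<noteq> 0 \<or> h (L1 - t) (a - 1) \<noteq> 0 \<and> e (M - t) (z - 1) \<noteq> 0"
  using assms by (auto simp: g_summand_def Let_def g_weight_def)

text \<open>For \<open>M = i + j\<close> one has \<open>M - t = x - c\<close>. The coefficient in
  \<open>h (x - c) c\<close> has upper entry \<open>x \<ge> 0\<close>, which forces
  \<open>c \<le> x\<close>; then the factors \<open>e (x - c)\<close> bound their indices.\<close>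

lemma g_summand_support_at_M:
  assumes "(a, b, c, x, y, z) \<in> g_index i j k" and nz: "g_summand L1 L2 (i + j) (a, b, c, x, y, z) \<noteq> 0"
  shows "c + y \<le> x" and "z \<le> x - c \<or> 1 \<le> a \<and> z - 1 \<le> x - c"
proof -
  have mt: "i + j - (a + b + c + x + y + z) = x - c" and nn: "0 \<le> c" "0 \<le> x"
    using assms(1) by (auto simp: g_index_def)
  note D = g_summand_nonzeroD[OF nz refl, unfolded mt]
  have xc: "0 \<le> x - c" using h_nonzeroD[OF D(3)] nn by simp
  show "c + y \<le> x" using e_nonzeroD[OF D(4) xc] by simp
  have "1 \<le> a" if "h l (a - 1) \<noteq> 0" for l using that h_neg[of "a - 1" l] by linarith
  then show "z \<le> x - c \<or> 1 \<le> a \<and> z - 1 \<le> x - c" using D(5) e_nonzeroD[OF _ xc] by blast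
qed

lemma g_summand_support_at_L2:
  assumes "(a, b, c, x, y, z) \<in> g_index i j k" and nz: "g_summand L1 (i + k) M (a, b, c, x, y, z) \<noteq> 0"
  shows "b + x \<le> y"
proof -
  have mt: "i + k - (a + b + c + x + y + z) = y - b" and nn: "0 \<le> b" "0 \<le> y"
    using assms(1) by (auto simp: g_index_def)
  note D = g_summand_nonzeroD[OF nz refl, unfolded mt]
  have xc: "0 \<le> y - b" using h_nonzeroD[OF D(1)] nn by simp
  show ?thesis using e_nonzeroD[OF D(2) xc] by simp
qed

lemma g_summand_support_at_L1_M:
  assumes "(a, b, c, x, y, z) \<in> g_index i j k" and nz: "g_summand (j + k) L2 (j + k) (a, b, c, x, y, z) \<noteq> 0"
  shows "a + y \<le> z"
proof -
  have mt: "j + k - (a + b + c + x + y + z) = z - a" and nn: "0 \<le> a" "0 \<le> z"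
    using assms(1) by (auto simp: g_index_def)
  note D = g_summand_nonzeroD[OF nz refl, unfolded mt]
  \<comment> \<open>In the second alternative the coefficient in \<open>h\<close> has upper entry
    \<open>z - 1\<close>, which must be nonnegative for \<open>h_nonzeroD\<close>.\<close>
  have "1 \<le> z" if "e l (z - 1) \<noteq> 0" for l using that e_neg[of "z - 1" l] by linarith
  then have xc: "0 \<le> z - a" using D(5) h_nonzeroD[of "z - a" a] h_nonzeroD[of "z - a" "a - 1"] nn by force
  show ?thesis using e_nonzeroD[OF D(4) xc] by simp
qed

text \<open>Either the index of the \<open>e\<close> factor exceeds \<open>N\<close>, or the
  coefficient in \<open>h (N - j) s\<close> has an upper entry between \<open>0\<close> and
  \<open>s - 1\<close>.\<close>

lemma V_eq_0: assumes "0 \<le> N" "N < j" shows "V N j s = 0"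
proof (cases "N < j - s")
  case True
  then show ?thesis using assms e_nonzeroD[of N "j - s"] by (force simp: V_def)
next
  case False
  then show ?thesis using assms h_nonzeroD[of "N - j" s] by (force simp: V_def)
qed

text \<open>On the left, \<open>c + y \<le> x\<close> yields \<open>k \<le> x + z \<le> j\<close>,
  and the other support condition yields \<open>k \<le> i\<close>, so no tuple survives. On the
  right, \<open>e 0 (k - s)\<close> requires \<open>s \<ge> k\<close>, which exceeds
  \<open>i\<close> or \<open>j\<close>.\<close>

lemma g_eq_p_at_M:
  assumes "k > i \<or> k > j" shows "g i j k L1 L2 (i + j) = p i j k L1 L2 (i + j)"
proof -
  have "g_summand L1 L2 (i + j) (a, b, c, x, y, z) = 0" if "(a, b, c, x, y, z) \<in> g_index i j k" for a b c x y z
    using g_summand_support_at_M[OF that, of L1 L2] that assms by (fastforce simp: g_index_def)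
  then have "g i j k L1 L2 (i + j) = 0" unfolding g_eq_sum_g_summand by (intro sum.neutral) auto
  moreover have "p_summand i j k L1 L2 (i + j) s = 0" for s
  proof (cases "s < k")
    case True
    then have "e 0 (k - s) = 0" using e_nonzeroD[of 0 "k - s"] by force
    then show ?thesis by (simp add: p_summand_def)
  next
    case False
    then show ?thesis using assms by (intro p_summand_neg) auto
  qed
  then have "p i j k L1 L2 (i + j) = 0" by (simp add: p_eq_sum_p_summand[of 0 i i])
  ultimately show ?thesis by simp
qed

text \<open>On the left, \<open>b + x \<le> y\<close> would give \<open>j \<le> k\<close>; on the
  right, \<open>V\<close> vanishes since \<open>L2 - i = k < j\<close>.\<close>

lemma g_eq_p_at_L2:
  assumes "j > k" "k \<ge> 0" shows "g i j k L1 (i + k) M = p i j k L1 (i + k) M"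
proof -
  have "g_summand L1 (i + k) M (a, b, c, x, y, z) = 0" if "(a, b, c, x, y, z) \<in> g_index i j k" for a b c x y z
    using g_summand_support_at_L2[OF that, of L1 M] that assms by (fastforce simp: g_index_def)
  then have "g i j k L1 (i + k) M = 0" unfolding g_eq_sum_g_summand by (intro sum.neutral) auto
  moreover have "p i j k L1 (i + k) M = 0"
    using assms by (simp add: p_eq_sum_p_summand[of 0 i i] p_summand_def V_eq_0)
  ultimately show ?thesis by simp
qed

text \<open>On the left, \<open>a + y \<le> z\<close> would give \<open>i \<le> j\<close>. The
  choice \<open>L2 = i\<close> makes the first argument of \<open>V\<close> zero, which settles the
  right for \<open>j > 0\<close>.\<close>

lemma g_eq_p_at_L1_M:
  assumes "i > j" "j \<ge> 0" "k \<ge> 0" shows "g i j k (j + k) i (j + k) = p i j k (j + k) i (j + k)"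
proof -
  have "g_summand (j + k) i (j + k) (a, b, c, x, y, z) = 0" if "(a, b, c, x, y, z) \<in> g_index i j k" for a b c x y z
    using g_summand_support_at_L1_M[OF that, of i] that assms by (fastforce simp: g_index_def)
  then have "g i j k (j + k) i (j + k) = 0" unfolding g_eq_sum_g_summand by (intro sum.neutral) auto
  moreover have "p_summand i j k (j + k) i (j + k) s = 0" for s
  proof (cases "j > 0")
    case True
    then show ?thesis by (simp add: p_summand_def V_eq_0)
  next
    case False
    then have [simp]: "j = 0" using assms by simp
    \<comment> \<open>The first factor vanishes for \<open>k < i\<close>, the second for
      \<open>k \<ge> i\<close>, because \<open>i > 0\<close>.\<close>
    have "e k i * e (k - i) k = 0" 
      using e_nonzeroD[of k i] e_nonzeroD[of "k - i" k] assms by force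
    then have "p_summand i j k (j + k) i (j + k) 0 = 0" by (auto simp: p_summand_def)
    moreover have "p_summand i j k (j + k) i (j + k) s = 0" if "s \<noteq> 0"
      using that by (intro p_summand_neg) auto
    ultimately show ?thesis by (cases "s = 0") auto
  qed
  then have "p i j k (j + k) i (j + k) = 0" by (simp add: p_eq_sum_p_summand[of 0 i i])
  ultimately show ?thesis by simp
qed

lemma h_0_right [simp]: "h N 0 = 1" and e_0_right [simp]: "e N 0 = 1"
  by (simp_all add: h_def e_def T_def)

lemma h_0_left: "n \<ge> 0 \<Longrightarrow> h 0 n = 1"
  by (simp add: h_def qb_self)

lemma e_self: "n \<ge> 0 \<Longrightarrow> e n n = q powi T n"
  by (simp add: e_def qb_self)

lemma g_eq_p_at_diagonal:
  assumes "n \<ge> 0" shows "g n n n L1 (n + n) (n + n) = p n n n L1 (n + n) (n + n)"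
proof -
  define m d where "m = n div 2" and "d = n mod 2"
  have n: "n = 2 * m + d" and d: "d = 0 \<or> d = 1" and m: "m \<ge> 0"
    using assms by (auto simp: m_def d_def)
  \<comment> \<open>The support conditions force \<open>b = c = 0\<close> and \<open>x = y\<close>;
    then \<open>z = a + x\<close> with \<open>a = 0\<close> or \<open>a = 1\<close>, so
    \<open>a\<close> is the parity of \<open>n\<close>.\<close>
  let ?I = "(d, 0, 0, m, m, m + d)"
  have "g_summand L1 (n + n) (n + n) (a, b, c, x, y, z) = 0"
    if I: "(a, b, c, x, y, z) \<in> g_index n n n" and ne: "(a, b, c, x, y, z) \<noteq> ?I" for a b c x y z
  proof (rule ccontr)
    assume nz: "g_summand L1 (n + n) (n + n) (a, b, c, x, y, z) \<noteq> 0"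
    have "0 \<le> a" "0 \<le> b" "0 \<le> c" "n = a + x + y" "n = b + x + z" "n = c + y + z"
      using I by (auto simp: g_index_def)
    moreover note g_summand_support_at_M[OF I nz] g_summand_support_at_L2[OF I nz]
    ultimately have "b = 0" "c = 0" "x = y" "z \<le> x \<and> n = a + 2 * x \<or> 1 \<le> a \<and> z - 1 \<le> x \<and> n = a + 2 * x" "n = x + z"
      by linarith+
    then show False using ne n d \<open>0 \<le> a\<close> by auto presburger+
  qed
  then have zero: "g_summand L1 (n + n) (n + n) v = 0" if "v \<in> g_index n n n - {?I}" for v
    using that by (cases v) blast
  moreover have "?I \<in> g_index n n n" using n d m by (auto simp: g_index_def)
  ultimately have "g n n n L1 (n + n) (n + n) = g_summand L1 (n + n) (n + n) ?I"
    unfolding g_eq_sum_g_summand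
    using sum.remove[OF finite_g_index, of ?I n n n "g_summand L1 (n + n) (n + n)"]
      sum.neutral[of "g_index n n n - {?I}" "g_summand L1 (n + n) (n + n)"] by simp
  also have "\<dots> = q powi T (3 * m + 2 * d) * g_weight (L1 - (3 * m + 2 * d)) m m d 0 0 m m (m + d)"
    by (rule g_summand_eq) (simp_all add: n)
  also have "\<dots> = q powi (T (3 * m + 2 * d) + 3 * T m)"
  proof -
    \<comment> \<open>One term of the weight survives: the first for \<open>d = 0\<close>, as
      \<open>h l (-1) = 0\<close>, and the second for \<open>d = 1\<close>, by this vanishing.
      Either way its value is the cube of \<open>e m m\<close>.\<close>
    have "e m (m + 1) = 0" using e_nonzeroD[of m "m + 1"] m by force
    then have "g_weight l m m d 0 0 m m (m + d) = q powi T m * q powi T m * q powi T m" for l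
      using d m by (auto simp: g_weight_def e_self)
    moreover have "3 * T m = T m + T m + T m" by simp
    ultimately show ?thesis by (simp only: powi_add mult.assoc)
  qed
  also have "T (3 * m + 2 * d) + 3 * T m = n * (n + n + 2) - T n"
  proof -
    have "2 * (T (3 * m + 2 * d) + 3 * T m) = 2 * (n * (n + n + 2) - T n)"
      unfolding distrib_left right_diff_distrib mult.left_commute[of 2 3] two_T n
      using d by (elim disjE) (simp_all add: algebra_simps)
    then show ?thesis by simp
  qed
  \<comment> \<open>At \<open>s = n\<close> every factor but \<open>w\<close> is \<open>1\<close>;
    smaller \<open>s\<close> are removed by \<open>e 0 (n - s)\<close>, since
    \<open>M - i - j = 0\<close>.\<close>
  also have "q powi (n * (n + n + 2) - T n) = p_summand n n n L1 (n + n) (n + n) n"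
    using assms by (simp add: p_summand_def w_def V_def h_0_left)
  also have "\<dots> = p n n n L1 (n + n) (n + n)"
  proof -
    have "p_summand n n n L1 (n + n) (n + n) s = 0" if "s < n" for s
      using e_nonzeroD[of 0 "n - s"] that by (force simp: p_summand_def)
    then show ?thesis using assms
      by (subst p_eq_sum_p_summand[of 0 _ n], simp, simp, subst sum.remove[of _ n]) (auto intro!: sum.neutral)
  qed
  finally show ?thesis .
qed

section \<open>Induction on the sum of the indices\<close>

lemma int_fun_const:
  fixes f :: "int \<Rightarrow> 'b"
  assumes "\<And>n. f n = f (n - 1)"
  shows "f m = f n"
proof -
  have "f m = f 0" for m
  proof (induction m rule: int_induct[of _ 0])
    case (step1 i) then show ?case using assms[of "i + 1"] by simp
  next
    case (step2 i) then show ?case using assms[of i] by simp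
  qed simp
  then show ?thesis by metis
qed

theorem g_eq_p: "g i j k L1 L2 M = p i j k L1 L2 M"
proof (induction "nat (i + j + k)" arbitrary: i j k L1 L2 M rule: less_induct)
  case less
  show ?case
  proof (cases "i < 0 \<or> j < 0 \<or> k < 0")
    case True
    then show ?thesis using g_neg p_neg by metis
  next
    case False
    \<comment> \<open>The recurrences reach triples with negative entries, where the truncated
      measure need not drop; there both sides are \<open>0\<close>.\<close>
    have IH: "g i' j' k' L1 L2 M = p i' j' k' L1 L2 M" if "i' + j' + k' < i + j + k" for i' j' k' L1 L2 M
    proof (cases "i' < 0 \<or> j' < 0 \<or> k' < 0")
      case True
      then show ?thesis using g_neg p_neg by metis
    next
      case False
      then show ?thesis using that by (intro less) auto
    qed
    define D where "D L1 L2 M = g i j k L1 L2 M - p i j k L1 L2 M" for L1 L2 M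
    have "D L1 L2 M = D (L1 - 1) L2 M" for L1 L2 M
      unfolding D_def g_rec_L1[of i j k L1] p_rec_L1[of i j k L1] by (simp add: IH)
    then have D1: "D L1 L2 M = D L1' L2 M" for L1 L1' L2 M
      by (rule int_fun_const)
    have "D L1 L2 M = D L1 (L2 - 1) M" for L1 L2 M
      unfolding D_def g_rec_L2[of i j k L1 L2] p_rec_L2[of i j k L1 L2] by (simp add: IH)
    then have D2: "D L1 L2 M = D L1 L2' M" for L1 L2 L2' M
      by (rule int_fun_const[where f = "\<lambda>L2. D L1 L2 M"])
    have "D L1 L2 M = D L1 L2 (M - 1)" for L1 L2 M
      unfolding D_def g_rec_M[of i j k L1 L2 M] p_rec_M[of i j k L1 L2 M] by (simp add: IH)
    then have D3: "D L1 L2 M = D L1 L2 M'" for L1 L2 M M'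
      by (rule int_fun_const)
    have const: "D L1 L2 M = D L1' L2' M'" for L1 L2 M L1' L2' M'
      using D1 D2 D3 by metis
    \<comment> \<open>If the first three cases fail, then \<open>k \<le> i \<le> j \<le> k\<close>,
      so all three indices agree.\<close>
    consider "k > i \<or> k > j" | "j > k" | "i > j" | "i = j" "k = j" by linarith
    then have "\<exists>L1' L2' M'. D L1' L2' M' = 0"
    proof cases
      case 1
      then show ?thesis using g_eq_p_at_M[of i k j] by (metis D_def right_minus_eq)
    next
      case 2
      then show ?thesis using g_eq_p_at_L2[of k j] False by (metis D_def right_minus_eq not_less)
    next
      case 3
      then show ?thesis using g_eq_p_at_L1_M[of j i k] False by (metis D_def right_minus_eq not_less)
    next
      case 4
      then show ?thesis using g_eq_p_at_diagonal[of i] False by (metis D_def right_minus_eq not_less)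
    qed
    then have "D L1 L2 M = 0" using const by metis
    then show ?thesis by (simp add: D_def)
  qed
qed

end

section \<open>Specialisation to the indeterminate\<close>

lemma generic_q_fls_X: "generic_q (fls_X :: rat fls)"
proof
  show "fls_X ^ n \<noteq> (1 :: rat fls)" if "0 < n" for n
  proof
    assume "fls_X ^ n = (1 :: rat fls)"
    \<comment> \<open>A positive power of the indeterminate has constant coefficient
      \<open>0\<close>.\<close>
    then have "fls_nth (fls_X ^ n :: rat fls) 0 = 1" by simp
    then show False using that by (simp add: fls_X_power_nth)
  qed
qed simp

theorem theorem5:
  fixes i j k L1 L2 M :: int
  shows "g_sum (fls_X :: rat fls) i j k L1 L2 M = p_sum (fls_X :: rat fls) i j k L1 L2 M"
  by (rule generic_q.g_eq_p[OF generic_q_fls_X])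

end
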